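(* Let $X$ be a universal uniform space, let $Y$ be a coverable uniform space, and let $f:X\to Y$ be uniformly continuous and basepoint-preserving. Then there exists a unique uniformly continuous basepoint-preserving function $f_L:X\to\widetilde{Y}$ such that $f=\phi\circ f_L$, where $\phi:\widetilde{Y}\to Y$ is the universal cover of $Y$.
   Context: All entourages are taken to be symmetric; $B(x,E)=\{y:(x,y)\in E\}$. Each space has a fixed basepoint $*$. For an entourage $E$ of a uniform space $X$, an $E$-chain from $p$ to $q$ is a finite sequence $\{x_0=p,\dots,x_n=q\}$ with $(x_i,x_{i+1})\in E$ for all $i$. Two $E$-chains with the same endpoints are $E$-homotopic if one is obtained from the other in finitely many steps, each adding or removing a single point, always keeping the endpoints fixed and keeping an $E$-chain at each stage (in particular $\{p\}$ and $\{p,p\}$ are $E$-homotopic); $[\alpha]_E$ is the class of $\alpha$. $X_E$ is the set of $E$-homotopy classes of $E$-chains starting at $*$, with basepoint $[*]_E$. For an entourage $D\subset E$ let $D^*$ be the set of pairs $([*=x_0,\dots,x_n,y]_E,[*=x_0,\dots,x_n,z]_E)$ with $(y,z)\in D$; $X_E$ carries the uniformity with base $\{D^*:D\subset E\}$. The endpoint map is $\phi_{XE}:X_E\to X$, and for $D\subset E$, $\phi_{ED}:X_D\to X_E$ is $[\alpha]_D\mapsto[\alpha]_E$. $\widetilde{X}=\varprojlim X_E$ (over all entourages, ordered by reverse inclusion, with the inverse limit uniformity and basepoint $([*]_E)_E$), with projections $\phi_E:\widetilde{X}\to X_E$ and $\phi:\widetilde{X}\to X=X_{X\times X}$. $X$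 is coverable if its uniformity has a base, containing $X\times X$, of entourages $E$ for which $\phi_E$ is surjective; then $\phi:\widetilde X\to X$ is called the universal cover of $X$. $X$ is universal if its uniformity has a base $\mathcal{U}$ such that for every $E\in\mathcal{U}$ the map $\phi_{XE}:X_E\to X$ is a uniform homeomorphism. *)

theory Defs
  imports "HOL-Analysis.Analysis"
begin

text \<open>
  Base spaces are types of class \<open>uniform_space\<close>. The derived spaces depend on an entourage and
  live on proper subsets of a type, so they are given by a carrier set together with a filter on
  pairs, in the same way that \<open>uniformity_on\<close> is.
\<close>

definition uniform_map ::
  "'a set \<Rightarrow> ('a \<times> 'a) filter \<Rightarrow> 'b set \<Rightarrow> ('b \<times> 'b) filter \<Rightarrow> ('a \<Rightarrow> 'b) \<Rightarrow> bool" where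
  "uniform_map S U T V f \<longleftrightarrow> f \<in> S \<rightarrow> T \<and> (LIM (x, y) U. (f x, f y) :> V)"

lemma uniform_map_UNIV:
  "uniform_map UNIV uniformity UNIV uniformity f \<longleftrightarrow> uniformly_continuous_on UNIV f"
  by (simp add: uniform_map_def uniformly_continuous_on_uniformity)

definition uniform_homeomorphism ::
  "'a set \<Rightarrow> ('a \<times> 'a) filter \<Rightarrow> 'b set \<Rightarrow> ('b \<times> 'b) filter \<Rightarrow> ('a \<Rightarrow> 'b) \<Rightarrow> bool" where
  "uniform_homeomorphism S U T V f \<longleftrightarrow>
     bij_betw f S T \<and> uniform_map S U T V f \<and> uniform_map T V S U (inv_into S f)"


definition entourages :: "('a::uniform_space \<times> 'a) set set" where
  "entourages = {E. sym E \<and> (\<forall>\<^sub>F p in uniformity. p \<in> E)}"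

definition uniformity_base :: "('a::uniform_space \<times> 'a) set set \<Rightarrow> bool" where
  "uniformity_base \<U> \<longleftrightarrow> \<U> \<subseteq> entourages \<and> (\<forall>E\<in>entourages. \<exists>D\<in>\<U>. D \<subseteq> E)"

text \<open>A chain is the nonempty list of its points.\<close>

definition is_chain :: "('a \<times> 'a) set \<Rightarrow> 'a list \<Rightarrow> bool" where
  "is_chain E xs \<longleftrightarrow> xs \<noteq> [] \<and> successively (\<lambda>x y. (x, y) \<in> E) xs"

text \<open>
  One elementary move: \<open>ys\<close> is \<open>xs\<close> with one point added. The point may be put first or last as
  long as it repeats the endpoint, so \<open>[p]\<close> can be changed to \<open>[p, p]\<close>.
\<close>

definition add_point :: "('a \<times> 'a) set \<Rightarrow> 'a list \<Rightarrow> 'a list \<Rightarrow> bool" where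
  "add_point E xs ys \<longleftrightarrow> is_chain E xs \<and> is_chain E ys \<and> hd xs = hd ys \<and> last xs = last ys \<and>
     (\<exists>us vs x. xs = us @ vs \<and> ys = us @ x # vs)"

definition chain_homotopy :: "('a \<times> 'a) set \<Rightarrow> ('a list \<times> 'a list) set" where
  "chain_homotopy E = {(xs, ys). is_chain E xs \<and> is_chain E ys \<and> equivclp (add_point E) xs ys}"

definition chain_class :: "('a \<times> 'a) set \<Rightarrow> 'a list \<Rightarrow> 'a list set" where
  "chain_class E xs = chain_homotopy E `` {xs}"

text \<open>The spaces $X_E$, with basepoint \<open>chain_class E [b]\<close>.\<close>

definition chain_space :: "'a \<Rightarrow> ('a \<times> 'a) set \<Rightarrow> 'a list set set" where
  "chain_space b E = {xs. is_chain E xs \<and> hd xs = b} // chain_homotopy E"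

text \<open>The set written $D^*$.\<close>

definition chain_entourage ::
  "'a \<Rightarrow> ('a \<times> 'a) set \<Rightarrow> ('a \<times> 'a) set \<Rightarrow> ('a list set \<times> 'a list set) set" where
  "chain_entourage b E D =
     {(chain_class E (xs @ [y]), chain_class E (xs @ [z])) | xs y z.
        xs \<noteq> [] \<and> hd xs = b \<and> is_chain E (xs @ [y]) \<and> is_chain E (xs @ [z]) \<and> (y, z) \<in> D}"

definition chain_uniformity ::
  "'a::uniform_space \<Rightarrow> ('a \<times> 'a) set \<Rightarrow> ('a list set \<times> 'a list set) filter" where
  "chain_uniformity b E = (INF D\<in>{D \<in> entourages. D \<subseteq> E}. principal (chain_entourage b E D))"

text \<open>The endpoint map $X_E \to X$: the common last point of the chains in a class.\<close>

definition endpoint :: "'a list set \<Rightarrow> 'a" where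
  "endpoint c = the_elem (last ` c)"

text \<open>
  The map $\phi_{ED}\colon X_D \to X_E$ for \<open>D \<subseteq> E\<close>. It does not mention \<open>D\<close>: the image of a class
  \<open>chain_class D xs\<close> under the coarser relation is \<open>chain_class E xs\<close>, see
  \<open>bonding_map_chain_class\<close> below.
\<close>

definition bonding_map :: "('a \<times> 'a) set \<Rightarrow> 'a list set \<Rightarrow> 'a list set" where
  "bonding_map E c = chain_homotopy E `` c"

text \<open>
  The inverse limit $\widetilde X$ over all entourages. Threads are extensional functions, so that
  equality of threads is equality at all entourages; the projection to $X_E$ is evaluation at \<open>E\<close>.
\<close>

definition cover_space :: "'a::uniform_space \<Rightarrow> (('a \<times> 'a) set \<Rightarrow> 'a list set) set" where
  "cover_space b =
     {t \<in> (\<Pi>\<^sub>E E\<in>entourages. chain_space b E).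
        \<forall>D\<in>entourages. \<forall>E\<in>entourages. D \<subseteq> E \<longrightarrow> bonding_map E (t D) = t E}"

definition cover_uniformity ::
  "'a::uniform_space \<Rightarrow>
     ((('a \<times> 'a) set \<Rightarrow> 'a list set) \<times> (('a \<times> 'a) set \<Rightarrow> 'a list set)) filter" where
  "cover_uniformity b =
     inf (INF E\<in>entourages. filtercomap (\<lambda>(s, t). (s E, t E)) (chain_uniformity b E))
         (principal (cover_space b \<times> cover_space b))"

definition cover_basepoint :: "'a::uniform_space \<Rightarrow> ('a \<times> 'a) set \<Rightarrow> 'a list set" where
  "cover_basepoint b = (\<lambda>E\<in>entourages. chain_class E [b])"

text \<open>
  The map $\phi\colon \widetilde X \to X$ is the projection to the full entourage \<open>UNIV\<close>, where $X_{X\times X}$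
  is identified with $X$ by the endpoint map.
\<close>

definition cover_map :: "(('a \<times> 'a) set \<Rightarrow> 'a list set) \<Rightarrow> 'a" where
  "cover_map t = endpoint (t UNIV)"

definition coverable :: "'a::uniform_space \<Rightarrow> bool" where
  "coverable b \<longleftrightarrow>
     (\<exists>\<U>. uniformity_base \<U> \<and> UNIV \<in> \<U> \<and>
        (\<forall>E\<in>\<U>. (\<lambda>t. t E) ` cover_space b = chain_space b E))"

definition universal :: "'a::uniform_space \<Rightarrow> bool" where
  "universal b \<longleftrightarrow>
     (\<exists>\<U>. uniformity_base \<U> \<and>
        (\<forall>E\<in>\<U>. uniform_homeomorphism
           (chain_space b E) (chain_uniformity b E) UNIV uniformity endpoint))"


lemma add_point_mono: "add_point D xs ys \<Longrightarrow> D \<subseteq> E \<Longrightarrow> add_point E xs ys"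
  unfolding add_point_def is_chain_def by (auto elim!: successively_mono)

lemma equivclp_add_point_mono:
  assumes "equivclp (add_point D) xs ys" "D \<subseteq> E"
  shows "equivclp (add_point E) xs ys"
  using assms(1)
  by (induction rule: equivclp_induct)
     (use assms(2) in \<open>auto intro: equivclp_into_equivclp dest: add_point_mono\<close>)

lemma equiv_chain_homotopy: "equiv {xs. is_chain E xs} (chain_homotopy E)"
  unfolding chain_homotopy_def
  by (auto simp: equiv_def refl_on_def sym_def trans_def
           intro: equivclp_sym equivclp_trans)

lemma chain_homotopy_endpoints:
  assumes "(xs, ys) \<in> chain_homotopy E"
  shows "hd xs = hd ys" "last xs = last ys"
proof -
  have "equivclp (add_point E) xs ys"
    using assms by (simp add: chain_homotopy_def)
  then have "hd xs = hd ys \<and> last xs = last ys"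
    by (induction rule: equivclp_induct) (auto simp: add_point_def)
  then show "hd xs = hd ys" "last xs = last ys" by auto
qed

lemma chain_class_eq_iff:
  assumes "is_chain E xs" "is_chain E ys"
  shows "chain_class E xs = chain_class E ys \<longleftrightarrow> equivclp (add_point E) xs ys"
  using eq_equiv_class_iff[OF equiv_chain_homotopy, of xs E ys] assms
  by (simp add: chain_class_def chain_homotopy_def)

lemma endpoint_chain_class:
  assumes "is_chain E xs"
  shows "endpoint (chain_class E xs) = last xs"
proof -
  have "xs \<in> chain_class E xs"
    using assms by (simp add: chain_class_def chain_homotopy_def)
  then have "last ` chain_class E xs = {last xs}"
    using chain_homotopy_endpoints(2) by (fastforce simp: chain_class_def)
  then show ?thesis by (simp add: endpoint_def)
qed

lemma bonding_map_chain_class: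
  assumes "is_chain D xs" "D \<subseteq> E"
  shows "bonding_map E (chain_class D xs) = chain_class E xs"
proof -
  have "chain_homotopy D \<subseteq> chain_homotopy E"
    using assms(2) equivclp_add_point_mono[OF _ assms(2)]
    by (auto simp: chain_homotopy_def is_chain_def elim!: successively_mono)
  moreover have "xs \<in> chain_class D xs"
    using assms(1) by (simp add: chain_class_def chain_homotopy_def)
  ultimately show ?thesis
    using equiv_chain_homotopy[of E]
    by (fastforce simp: bonding_map_def chain_class_def equiv_def dest: transD)
qed

lemma entourages_Int: "D \<in> entourages \<Longrightarrow> E \<in> entourages \<Longrightarrow> D \<inter> E \<in> entourages"
  by (auto simp: entourages_def sym_def eventually_conj)

text \<open>The sets \<open>chain_entourage b E D\<close> form a base of the uniformity of \<open>chain_space b E\<close>.\<close>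

lemma eventually_chain_uniformity:
  assumes "E \<in> entourages"
  shows "eventually P (chain_uniformity b E) \<longleftrightarrow>
           (\<exists>D\<in>entourages. D \<subseteq> E \<and> (\<forall>p\<in>chain_entourage b E D. P p))"
proof -
  have "\<exists>D\<in>{D \<in> entourages. D \<subseteq> E}. principal (chain_entourage b E D) \<le>
          inf (principal (chain_entourage b E D1)) (principal (chain_entourage b E D2))"
    if "D1 \<in> {D \<in> entourages. D \<subseteq> E}" "D2 \<in> {D \<in> entourages. D \<subseteq> E}" for D1 D2
  proof
    show "D1 \<inter> D2 \<in> {D \<in> entourages. D \<subseteq> E}"
      using that entourages_Int by auto
    show "principal (chain_entourage b E (D1 \<inter> D2)) \<le>
          inf (principal (chain_entourage b E D1)) (principal (chain_entourage b E D2))"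
      by (fastforce simp: chain_entourage_def)
  qed
  then show ?thesis
    unfolding chain_uniformity_def using assms
    by (subst eventually_INF_base) (auto simp: eventually_principal)
qed

text \<open>The identification of $X_{X\times X}$ with $X$ used in \<open>cover_map\<close>.\<close>

lemma bij_betw_endpoint_UNIV: "bij_betw endpoint (chain_space b UNIV) UNIV"
proof -
  have chain: "is_chain UNIV xs \<longleftrightarrow> xs \<noteq> []" for xs :: "'a list"
    by (induction xs rule: induct_list012) (auto simp: is_chain_def)
  have reduce: "equivclp (add_point UNIV) [x, last (x # xs)] (x # xs)" for x :: 'a and xs
  proof (induction xs)
    case Nil
    have "add_point UNIV [x] [x, x]"
      unfolding add_point_def by (simp add: chain) (metis append_Nil)
    then show ?case by auto
  next
    case (Cons y ys)
    show ?case
    proof (cases "ys = []")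
      case False
      have "add_point UNIV (x # ys) (x # y # ys)"
        unfolding add_point_def using False
        by (auto simp: chain) (metis append_Cons append_Nil)
      with Cons False show ?thesis by (auto intro: equivclp_into_equivclp)
    qed simp
  qed
  have eq: "chain_class UNIV xs = chain_class UNIV [hd xs, last xs]" if "xs \<noteq> []" for xs :: "'a list"
    using that reduce[of "hd xs" "tl xs"] by (auto simp: chain_class_eq_iff chain equivclp_sym)
  have space: "chain_space b UNIV = chain_class UNIV ` {xs. xs \<noteq> [] \<and> hd xs = b}"
    by (auto simp: chain_space_def quotient_def chain_class_def chain)
  show ?thesis
  proof (rule bij_betwI')
    fix c d assume "c \<in> chain_space b UNIV" "d \<in> chain_space b UNIV"
    then obtain xs ys where "c = chain_class UNIV xs" "d = chain_class UNIV ys"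
      "xs \<noteq> []" "ys \<noteq> []" "hd xs = b" "hd ys = b"
      by (auto simp: space)
    then show "endpoint c = endpoint d \<longleftrightarrow> c = d"
      using eq[of xs] eq[of ys] by (metis chain endpoint_chain_class)
  next
    fix y :: 'a
    have "chain_class UNIV [b, y] \<in> chain_space b UNIV" by (auto simp: space)
    moreover have "y = endpoint (chain_class UNIV [b, y])"
      by (simp add: endpoint_chain_class chain)
    ultimately show "\<exists>c\<in>chain_space b UNIV. y = endpoint c" by blast
  qed simp
qed

end

theory Submission
  imports Defs
begin

text \<open>
  The proof is path lifting with chains in place of paths. If \<open>f\<close> carries an entourage \<open>D\<close> of
  $X$ into an entourage \<open>E\<close> of $Y$, then it carries \<open>D\<close>-chains to \<open>E\<close>-chains and \<open>D\<close>-homotopies to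
  \<open>E\<close>-homotopies. Universality of $X$ makes $X_D \to X$ bijective for the
  entourages \<open>D\<close> of a base: surjectivity says that every point is joined to the basepoint by a
  \<open>D\<close>-chain, and injectivity that any two such chains are \<open>D\<close>-homotopic.

  \<^emph>\<open>Existence.\<close> The \<open>E\<close>-coordinate of the lift of \<open>x\<close> is the \<open>E\<close>-class of the image of any
  \<open>D\<close>-chain from the basepoint to \<open>x\<close>, where \<open>D\<close> is a basic entourage that \<open>f\<close> carries into
  \<open>E\<close>. Neither the chain nor \<open>D\<close> matters (\<open>chain_lift_eq\<close>). The freedom to choose \<open>D\<close> gives
  compatibility of the coordinates, and the freedom to choose the chain gives uniform continuity:
  for nearby \<open>x\<close>, \<open>y\<close> one may use chains that differ only in their last point.

  \<^emph>\<open>Uniqueness.\<close> The endpoint map $Y_E \to Y$ is injective on each ball of the entourage $E^*$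
  (\<open>chain_entourage_right_unique\<close>). Hence, if the \<open>E\<close>-coordinates of two lifts agree at a
  point, they agree at all points sufficiently near to it. How near depends on \<open>E\<close> but, by uniform
  continuity, not on the point, so the agreement propagates along a chain from the basepoint to any point.
\<close>

section \<open>Chains and their homotopies\<close>

lemma is_chain_snoc:
  "is_chain E (xs @ [z]) \<longleftrightarrow> xs = [] \<or> is_chain E xs \<and> (last xs, z) \<in> E"
  by (auto simp: is_chain_def successively_append_iff)

lemma is_chain_mono: "is_chain D xs \<Longrightarrow> D \<subseteq> E \<Longrightarrow> is_chain E xs"
  unfolding is_chain_def by (auto elim!: successively_mono)

lemma is_chain_map:
  assumes "is_chain D xs" "\<And>x y. (x, y) \<in> D \<Longrightarrow> (f x, f y) \<in> E"
  shows "is_chain E (map f xs)"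
  using assms unfolding is_chain_def by (auto simp: successively_map elim!: successively_mono)

lemma equivclp_add_point_map:
  assumes "equivclp (add_point D) xs ys" "\<And>x y. (x, y) \<in> D \<Longrightarrow> (f x, f y) \<in> E"
  shows "equivclp (add_point E) (map f xs) (map f ys)"
proof -
  have step: "add_point E (map f us) (map f vs)" if "add_point D us vs" for us vs
  proof -
    from that have ch: "is_chain D us" "is_chain D vs" "hd us = hd vs" "last us = last vs"
      and "\<exists>as bs x. us = as @ bs \<and> vs = as @ x # bs"
      by (auto simp: add_point_def)
    then have "\<exists>as bs x. map f us = as @ bs \<and> map f vs = as @ x # bs"
      by (metis map_append list.simps(9))
    moreover have "is_chain E (map f us)" "is_chain E (map f vs)"
      using ch assms(2) by (auto intro: is_chain_map)
    moreover have "hd (map f us) = hd (map f vs)" "last (map f us) = last (map f vs)"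
      using ch by (auto simp: is_chain_def hd_map last_map)
    ultimately show ?thesis unfolding add_point_def by blast
  qed
  from assms(1) show ?thesis
    by (induction rule: equivclp_induct) (auto intro: equivclp_into_equivclp dest: step)
qed

lemma equivclp_add_point_snoc:
  assumes "equivclp (add_point E) xs ys" "(last xs, z) \<in> E"
  shows "equivclp (add_point E) (xs @ [z]) (ys @ [z])"
proof -
  have snoc_step: "add_point E (us @ [z]) (vs @ [z])"
    if "add_point E us vs" "(last us, z) \<in> E" for us vs
  proof -
    from that have ch: "is_chain E us" "is_chain E vs" "hd us = hd vs" "last us = last vs"
      and "\<exists>as bs x. us = as @ bs \<and> vs = as @ x # bs"
      by (auto simp: add_point_def)
    then have "\<exists>as bs x. us @ [z] = as @ bs \<and> vs @ [z] = as @ x # bs"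
      by (metis append.assoc append_Cons)
    then show ?thesis
      using ch that(2) unfolding add_point_def
      by (auto simp: is_chain_snoc) (auto simp: is_chain_def hd_append)
  qed
  from assms(1) have "last ys = last xs \<and> equivclp (add_point E) (xs @ [z]) (ys @ [z])"
  proof (induction rule: equivclp_induct)
    case base
    show ?case by simp
  next
    case (step us vs)
    then have "last us = last vs" by (auto simp: add_point_def)
    then have "add_point E (us @ [z]) (vs @ [z]) \<or> add_point E (vs @ [z]) (us @ [z])"
      using step assms(2) snoc_step by metis
    with step \<open>last us = last vs\<close> show ?case
      by (auto intro: equivclp_into_equivclp)
  qed
  then show ?thesis ..
qed

lemma equivclp_add_point_penultimate:
  assumes "is_chain E (xs @ [y])" "is_chain E (xs @ [z])" "(y, z) \<in> E" "xs \<noteq> []"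
  shows "equivclp (add_point E) (xs @ [z]) (xs @ [y, z])"
proof -
  have "is_chain E ((xs @ [y]) @ [z])"
    using assms by (subst is_chain_snoc) auto
  then have "add_point E (xs @ [z]) (xs @ [y, z])"
    using assms unfolding add_point_def by auto
  then show ?thesis by auto
qed

lemma chain_space_eq: "chain_space b E = chain_class E ` {xs. is_chain E xs \<and> hd xs = b}"
  by (auto simp: chain_space_def quotient_def chain_class_def)

section \<open>Entourages\<close>

lemma UNIV_in_entourages: "UNIV \<in> entourages"
  by (simp add: entourages_def)

lemma entourage_refl: "E \<in> entourages \<Longrightarrow> (x, x) \<in> E"
  by (auto simp: entourages_def dest: uniformity_refl)

lemma eventually_uniformity_obtain_entourage:
  assumes "\<forall>\<^sub>F p in uniformity. P p"
  obtains D where "D \<in> entourages" "\<And>p. p \<in> D \<Longrightarrow> P p"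
proof
  show "{(x, y). P (x, y) \<and> P (y, x)} \<in> entourages"
    using eventually_conj[OF assms uniformity_sym[OF assms]]
    by (auto simp: entourages_def sym_def case_prod_unfold)
qed auto

lemma uniformly_continuous_vimage_entourage:
  assumes "uniformly_continuous_on UNIV f" "E \<in> entourages"
  shows "map_prod f f -` E \<in> entourages"
  using assms
  by (auto simp: entourages_def sym_def uniformly_continuous_on_uniformity filterlim_iff
      case_prod_unfold map_prod_def)

section \<open>The inverse limit\<close>

lemma uniform_map_cover_space_iff:
  "uniform_map UNIV uniformity (cover_space b) (cover_uniformity b) g \<longleftrightarrow>
     range g \<subseteq> cover_space b \<and>
     (\<forall>E\<in>entourages. \<forall>F\<in>entourages. F \<subseteq> E \<longrightarrow>
        (\<forall>\<^sub>F (x, y) in uniformity. (g x E, g y E) \<in> chain_entourage b E F))"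
proof (cases "range g \<subseteq> cover_space b")
  case True
  then have "\<forall>x. g x \<in> cover_space b" by auto
  then show ?thesis
    unfolding uniform_map_def cover_uniformity_def chain_uniformity_def
    by (auto simp: filterlim_inf filterlim_INF filterlim_filtercomap_iff filterlim_principal
        case_prod_unfold o_def)
qed (auto simp: uniform_map_def)

lemma endpoint_cover_space:
  assumes "t \<in> cover_space b" "E \<in> entourages"
  shows "endpoint (t E) = cover_map t"
proof -
  from assms have "t E \<in> chain_space b E" and bond: "bonding_map UNIV (t E) = t UNIV"
    by (auto simp: cover_space_def UNIV_in_entourages)
  then obtain xs where xs: "t E = chain_class E xs" "is_chain E xs"
    by (auto simp: chain_space_eq)
  then have "t UNIV = chain_class UNIV xs"
    using bond by (simp add: bonding_map_chain_class)
  with xs show ?thesis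
    by (simp add: cover_map_def endpoint_chain_class is_chain_mono[OF xs(2)])
qed

text \<open>
  A neighbour of the class of a chain ending in \<open>y\<close> is obtained by replacing \<open>y\<close> by a point \<open>z\<close>
  with \<open>(y, z) \<in> E\<close>. Up to homotopy this is the same as appending \<open>z\<close>, and appending is
  well-defined on classes; so the neighbour is determined by the class and \<open>z\<close>.
\<close>

lemma chain_entourage_right_unique:
  assumes "(c, d) \<in> chain_entourage b E E" "(c, d') \<in> chain_entourage b E E"
    and "endpoint d = endpoint d'"
  shows "d = d'"
proof -
  from assms(1) obtain xs y z where x: "xs \<noteq> []" "is_chain E (xs @ [y])" "is_chain E (xs @ [z])"
      "(y, z) \<in> E" and cd: "c = chain_class E (xs @ [y])" "d = chain_class E (xs @ [z])"
    by (auto simp: chain_entourage_def)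
  from assms(2) obtain xs' y' z' where x': "xs' \<noteq> []" "is_chain E (xs' @ [y'])"
      "is_chain E (xs' @ [z'])" "(y', z') \<in> E"
      and cd': "c = chain_class E (xs' @ [y'])" "d' = chain_class E (xs' @ [z'])"
    by (auto simp: chain_entourage_def)
  have [simp]: "y' = y" "z' = z"
    using cd cd' x x' assms(3) endpoint_chain_class[of E] by (metis last_snoc)+
  have "equivclp (add_point E) (xs @ [y]) (xs' @ [y])"
    using cd(1) cd'(1) x(2) x'(2) by (simp flip: chain_class_eq_iff)
  from equivclp_add_point_snoc[OF this, of z]
  have "equivclp (add_point E) (xs @ [y, z]) (xs' @ [y, z])"
    using x(4) by simp
  moreover have "equivclp (add_point E) (xs @ [z]) (xs @ [y, z])"
    using x by (intro equivclp_add_point_penultimate) auto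
  moreover have "equivclp (add_point E) (xs' @ [z]) (xs' @ [y, z])"
    using x' by (intro equivclp_add_point_penultimate) auto
  ultimately have "equivclp (add_point E) (xs @ [z]) (xs' @ [z])"
    by (meson equivclp_sym equivclp_trans)
  with cd cd' x x' show ?thesis by (simp add: chain_class_eq_iff)
qed

section \<open>Uniqueness of lifts\<close>

text \<open>
  For each coordinate \<open>E\<close> there is a single \<open>D\<close> such that both maps carry \<open>D\<close>-near points into
  $E^*$, so agreement passes from one point of a \<open>D\<close>-chain to the next.
\<close>

lemma uniform_lift_unique:
  fixes x0 :: "'a::uniform_space"
  assumes g: "uniform_map UNIV uniformity (cover_space b) (cover_uniformity b) g"
    and h: "uniform_map UNIV uniformity (cover_space b) (cover_uniformity b) h"
    and base: "g x0 = h x0"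
    and lifts: "cover_map \<circ> g = cover_map \<circ> h"
    and connected: "\<And>D x. D \<in> entourages \<Longrightarrow> \<exists>xs. is_chain D xs \<and> hd xs = x0 \<and> last xs = x"
  shows "g = h"
proof
  fix x
  have mem: "g y \<in> cover_space b" "h y \<in> cover_space b" for y
    using g h by (auto simp: uniform_map_def)
  have "g x E = h x E" if E: "E \<in> entourages" for E
  proof -
    have "\<forall>\<^sub>F p in uniformity. (g (fst p) E, g (snd p) E) \<in> chain_entourage b E E \<and>
        (h (fst p) E, h (snd p) E) \<in> chain_entourage b E E"
      using g h E by (auto simp: uniform_map_cover_space_iff case_prod_unfold eventually_conj_iff)
    then obtain D where D: "D \<in> entourages"
      and near: "\<And>p. p \<in> D \<Longrightarrow> (g (fst p) E, g (snd p) E) \<in> chain_entourage b E E \<and>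
        (h (fst p) E, h (snd p) E) \<in> chain_entourage b E E"
      by (rule eventually_uniformity_obtain_entourage) (rule that)
    have "g (last xs) E = h (last xs) E" if "is_chain D xs" "hd xs = x0" for xs
      using that
    proof (induction xs rule: rev_induct)
      case Nil
      then show ?case by (simp add: is_chain_def)
    next
      case (snoc z ys)
      show ?case
      proof (cases "ys = []")
        case True
        with snoc base show ?thesis by simp
      next
        case False
        with snoc have ys: "g (last ys) E = h (last ys) E" "(last ys, z) \<in> D"
          by (auto simp: is_chain_snoc)
        have "endpoint (g z E) = endpoint (h z E)"
          using endpoint_cover_space[OF mem(1) E] endpoint_cover_space[OF mem(2) E] lifts
          by (metis comp_apply)
        then have "g z E = h z E"
          using near[OF ys(2)] ys(1) by (metis chain_entourage_right_unique fst_conv snd_conv)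
        then show ?thesis by simp
      qed
    qed
    with connected[OF D, of x] show ?thesis by blast
  qed
  then show "g x = h x"
    using mem[of x] by (intro PiE_ext[of "g x" entourages "chain_space b" "h x"])
      (auto simp: cover_space_def)
qed

section \<open>Existence of lifts\<close>

text \<open>
  \<open>\<U>\<close> is a base of the uniformity of the domain. The description does not single out a member
  of \<open>\<U>\<close> for each \<open>E\<close>: being able to change it is what makes the coordinates compatible.
\<close>

definition chain_lift ::
  "('a \<times> 'a) set set \<Rightarrow> 'a \<Rightarrow> ('a \<Rightarrow> 'b::uniform_space) \<Rightarrow> 'a \<Rightarrow> ('b \<times> 'b) set \<Rightarrow> 'b list set" where
  "chain_lift \<U> x0 f x = (\<lambda>E\<in>entourages. THE c. \<exists>D\<in>\<U>. D \<subseteq> map_prod f f -` E \<and>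
     (\<exists>xs. is_chain D xs \<and> hd xs = x0 \<and> last xs = x \<and> c = chain_class E (map f xs)))"

text \<open>
  Chains ending at a given point exist and are unique up to homotopy at every scale in \<open>\<U>\<close>; this is
  the role that path connectedness and a trivial fundamental group play for lifting in topology.
\<close>

locale simply_chain_connected_base =
  fixes x0 :: "'a::uniform_space" and \<U> :: "('a \<times> 'a) set set"
  assumes base: "uniformity_base \<U>"
    and bij_endpoint: "D \<in> \<U> \<Longrightarrow> bij_betw endpoint (chain_space x0 D) UNIV"
begin

lemma ex_base:
  assumes "E \<in> entourages"
  obtains D where "D \<in> \<U>" "D \<in> entourages" "D \<subseteq> E"
  using assms base unfolding uniformity_base_def by blast

lemma ex_chain:
  assumes "D \<in> \<U>"
  obtains xs where "is_chain D xs" "hd xs = x0" "last xs = x"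
proof -
  from bij_endpoint[OF assms] obtain c where "c \<in> chain_space x0 D" "endpoint c = x"
    unfolding bij_betw_def by (metis UNIV_I imageE)
  then show thesis
    using that by (auto simp: chain_space_eq endpoint_chain_class)
qed

lemma chains_homotopic:
  assumes "D \<in> \<U>" "is_chain D xs" "is_chain D ys" "hd xs = x0" "hd ys = x0" "last xs = last ys"
  shows "equivclp (add_point D) xs ys"
proof -
  have "chain_class D xs = chain_class D ys"
  proof (rule inj_onD)
    show "inj_on endpoint (chain_space x0 D)"
      using bij_endpoint[OF assms(1)] by (simp add: bij_betw_def)
  qed (use assms in \<open>auto simp: chain_space_eq endpoint_chain_class\<close>)
  with assms show ?thesis by (simp add: chain_class_eq_iff)
qed

text \<open>
  Two chains for the same basic entourage are homotopic, hence so are their images. For chains of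
  different basic entourages, compare both with a chain that is fine for the two of them.
\<close>

lemma chain_class_map_eq:
  assumes "D \<in> \<U>" "D \<subseteq> map_prod f f -` E" "is_chain D xs" "hd xs = x0"
    and "D' \<in> \<U>" "D' \<subseteq> map_prod f f -` E" "is_chain D' ys" "hd ys = x0"
    and "last xs = last ys"
  shows "chain_class E (map f xs) = chain_class E (map f ys)"
proof -
  have "D \<in> entourages" "D' \<in> entourages"
    using assms(1,5) base by (auto simp: uniformity_base_def)
  then obtain D'' where D'': "D'' \<in> \<U>" "D'' \<subseteq> D \<inter> D'"
    using entourages_Int ex_base by metis
  obtain zs where zs: "is_chain D'' zs" "hd zs = x0" "last zs = last xs"
    using ex_chain[OF D''(1)] by metis
  have zs': "is_chain D zs" "is_chain D' zs"
    using zs(1) D''(2) by (auto intro: is_chain_mono)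
  have maps: "(f x, f y) \<in> E" if "(x, y) \<in> D \<or> (x, y) \<in> D'" for x y
    using that assms(2,6) by auto
  have "equivclp (add_point E) (map f xs) (map f zs)"
    by (rule equivclp_add_point_map[of D]) (use assms zs zs' maps in \<open>auto intro: chains_homotopic\<close>)
  moreover have "equivclp (add_point E) (map f ys) (map f zs)"
    by (rule equivclp_add_point_map[of D']) (use assms zs zs' maps in \<open>auto intro: chains_homotopic\<close>)
  ultimately have "equivclp (add_point E) (map f xs) (map f ys)"
    by (meson equivclp_sym equivclp_trans)
  moreover have "is_chain E (map f xs)" "is_chain E (map f ys)"
    using assms maps by (auto intro: is_chain_map)
  ultimately show ?thesis by (simp add: chain_class_eq_iff)
qed

lemma chain_lift_eq:
  assumes "E \<in> entourages" "D \<in> \<U>" "D \<subseteq> map_prod f f -` E" "is_chain D xs" "hd xs = x0"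
  shows "chain_lift \<U> x0 f (last xs) E = chain_class E (map f xs)"
  unfolding chain_lift_def restrict_apply'[OF assms(1)]
  by (rule the_equality) (use assms chain_class_map_eq in blast)+

context
  fixes f :: "'a \<Rightarrow> 'b::uniform_space"
  assumes f: "uniformly_continuous_on UNIV f"
begin

lemma ex_base_vimage:
  assumes "E \<in> entourages"
  obtains D where "D \<in> \<U>" "D \<in> entourages" "D \<subseteq> map_prod f f -` E"
    "\<And>xs. is_chain D xs \<Longrightarrow> is_chain E (map f xs)"
proof -
  obtain D where D: "D \<in> \<U>" "D \<in> entourages" "D \<subseteq> map_prod f f -` E"
    using uniformly_continuous_vimage_entourage[OF f assms] by (rule ex_base)
  moreover have "is_chain E (map f xs)" if "is_chain D xs" for xs
    using that by (rule is_chain_map) (use D(3) in auto)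
  ultimately show thesis using that by blast
qed

lemma chain_lift_in_cover_space: "chain_lift \<U> x0 f x \<in> cover_space (f x0)"
proof -
  have "chain_lift \<U> x0 f x E \<in> chain_space (f x0) E" if E: "E \<in> entourages" for E
  proof -
    obtain D where D: "D \<in> \<U>" "D \<subseteq> map_prod f f -` E"
        "\<And>xs. is_chain D xs \<Longrightarrow> is_chain E (map f xs)"
      using ex_base_vimage[OF E] by metis
    obtain xs where xs: "is_chain D xs" "hd xs = x0" "last xs = x"
      using ex_chain[OF D(1)] .
    then have "hd (map f xs) = f x0" by (auto simp: is_chain_def hd_map)
    with xs D chain_lift_eq[OF E D(1,2) xs(1,2)] show ?thesis by (auto simp: chain_space_eq)
  qed
  moreover have "bonding_map E' (chain_lift \<U> x0 f x E) = chain_lift \<U> x0 f x E'"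
    if E: "E \<in> entourages" "E' \<in> entourages" "E \<subseteq> E'" for E E'
  proof -
    \<comment> \<open>An entourage that is fine enough for \<open>E\<close> computes both coordinates from the same chain.\<close>
    obtain D where D: "D \<in> \<U>" "D \<subseteq> map_prod f f -` E"
        "\<And>xs. is_chain D xs \<Longrightarrow> is_chain E (map f xs)"
      using ex_base_vimage[OF E(1)] by metis
    obtain xs where xs: "is_chain D xs" "hd xs = x0" "last xs = x"
      using ex_chain[OF D(1)] .
    have "D \<subseteq> map_prod f f -` E'" using D(2) E(3) by auto
    from chain_lift_eq[OF E(2) D(1) this xs(1,2)] chain_lift_eq[OF E(1) D(1,2) xs(1,2)] xs D E
    show ?thesis by (auto simp: bonding_map_chain_class)
  qed
  ultimately show ?thesis
    by (auto simp: cover_space_def chain_lift_def)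
qed

lemma cover_map_chain_lift: "cover_map (chain_lift \<U> x0 f x) = f x"
proof -
  obtain D where D: "D \<in> \<U>" "D \<subseteq> map_prod f f -` UNIV"
      "\<And>xs. is_chain D xs \<Longrightarrow> is_chain UNIV (map f xs)"
    using ex_base_vimage[OF UNIV_in_entourages] by metis
  obtain xs where xs: "is_chain D xs" "hd xs = x0" "last xs = x"
    using ex_chain[OF D(1)] .
  then have "last (map f xs) = f x" by (auto simp: is_chain_def last_map)
  with chain_lift_eq[OF UNIV_in_entourages D(1,2) xs(1,2)] D(3)[OF xs(1)] xs(3)
  show ?thesis by (simp add: cover_map_def endpoint_chain_class)
qed

lemma chain_lift_basepoint: "chain_lift \<U> x0 f x0 = cover_basepoint (f x0)"
proof
  fix E
  show "chain_lift \<U> x0 f x0 E = cover_basepoint (f x0) E"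
  proof (cases "E \<in> entourages")
    case True
    obtain D where "D \<in> \<U>" "D \<subseteq> map_prod f f -` E"
      using ex_base_vimage[OF True] by metis
    from chain_lift_eq[OF True this, of "[x0]"] True show ?thesis
      by (simp add: cover_basepoint_def is_chain_def)
  qed (simp add: chain_lift_def cover_basepoint_def)
qed

lemma uniform_map_chain_lift:
  "uniform_map UNIV uniformity (cover_space (f x0)) (cover_uniformity (f x0)) (chain_lift \<U> x0 f)"
proof -
  have "\<forall>\<^sub>F (x, y) in uniformity.
      (chain_lift \<U> x0 f x E, chain_lift \<U> x0 f y E) \<in> chain_entourage (f x0) E F"
    if E: "E \<in> entourages" and F: "F \<in> entourages" for E F
  proof -
    obtain D where D: "D \<in> \<U>" "D \<in> entourages" "D \<subseteq> map_prod f f -` E"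
        "\<And>xs. is_chain D xs \<Longrightarrow> is_chain E (map f xs)"
      using ex_base_vimage[OF E] by metis
    have near: "(chain_lift \<U> x0 f x E, chain_lift \<U> x0 f y E) \<in> chain_entourage (f x0) E F"
      if xy: "(x, y) \<in> D" "(f x, f y) \<in> F" for x y
    proof -
      \<comment> \<open>Repeating \<open>x\<close> at the end of a chain to \<open>x\<close>, or appending \<open>y\<close> instead, gives chains to
        \<open>x\<close> and \<open>y\<close> that differ only in their last point.\<close>
      obtain xs where xs: "is_chain D xs" "hd xs = x0" "last xs = x"
        using ex_chain[OF D(1)] .
      have ne: "xs \<noteq> []" using xs by (auto simp: is_chain_def)
      have ch: "is_chain D (xs @ [x])" "is_chain D (xs @ [y])"
        using xs xy entourage_refl[OF D(2)] by (auto simp: is_chain_snoc)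
      have "chain_lift \<U> x0 f x E = chain_class E (map f xs @ [f x])"
        "chain_lift \<U> x0 f y E = chain_class E (map f xs @ [f y])"
        using chain_lift_eq[OF E D(1,3) ch(1)] chain_lift_eq[OF E D(1,3) ch(2)] xs ne by auto
      moreover have "map f xs \<noteq> []" "hd (map f xs) = f x0"
        using ne xs by (auto simp: hd_map)
      moreover have "is_chain E (map f xs @ [f x])" "is_chain E (map f xs @ [f y])"
        using D(4)[OF ch(1)] D(4)[OF ch(2)] by auto
      ultimately show ?thesis
        using xy(2) unfolding chain_entourage_def by blast
    qed
    have "D \<inter> map_prod f f -` F \<in> entourages"
      by (intro entourages_Int D uniformly_continuous_vimage_entourage f F)
    then have "\<forall>\<^sub>F p in uniformity. p \<in> D \<inter> map_prod f f -` F"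
      by (simp add: entourages_def)
    then show ?thesis
      by eventually_elim (use near in auto)
  qed
  then show ?thesis
    by (auto simp: uniform_map_cover_space_iff chain_lift_in_cover_space)
qed

end

end

section \<open>The lifting theorem\<close>

theorem theorem5:
  fixes x0 :: "'a::uniform_space" and y0 :: "'b::uniform_space" and f :: "'a \<Rightarrow> 'b"
  assumes "universal x0"
    and "coverable y0"
    and "uniformly_continuous_on UNIV f"
    and "f x0 = y0"
  shows "\<exists>!g :: 'a \<Rightarrow> ('b \<times> 'b) set \<Rightarrow> 'b list set.
           uniform_map UNIV uniformity (cover_space y0) (cover_uniformity y0) g \<and>
           g x0 = cover_basepoint y0 \<and>
           f = cover_map \<circ> g"
proof -
  from assms(1) obtain \<U> where "simply_chain_connected_base x0 \<U>"
    by (auto simp: universal_def simply_chain_connected_base_def uniform_homeomorphism_def)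
  then interpret simply_chain_connected_base x0 \<U> .
  have connected: "\<exists>xs. is_chain D xs \<and> hd xs = x0 \<and> last xs = x" if "D \<in> entourages" for D x
    using that by (metis ex_base ex_chain is_chain_mono)
  show ?thesis
  proof (rule ex1I[of _ "chain_lift \<U> x0 f"])
    show "uniform_map UNIV uniformity (cover_space y0) (cover_uniformity y0) (chain_lift \<U> x0 f) \<and>
        chain_lift \<U> x0 f x0 = cover_basepoint y0 \<and> f = cover_map \<circ> chain_lift \<U> x0 f"
      using uniform_map_chain_lift[OF assms(3)] chain_lift_basepoint[OF assms(3)]
        cover_map_chain_lift[OF assms(3)] assms(4)
      by (auto simp: comp_def)
  next
    fix g :: "'a \<Rightarrow> ('b \<times> 'b) set \<Rightarrow> 'b list set"
    assume g: "uniform_map UNIV uniformity (cover_space y0) (cover_uniformity y0) g \<and>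
        g x0 = cover_basepoint y0 \<and> f = cover_map \<circ> g"
    show "g = chain_lift \<U> x0 f"
    proof (rule uniform_lift_unique[OF _ _ _ _ connected])
      show "uniform_map UNIV uniformity (cover_space y0) (cover_uniformity y0) (chain_lift \<U> x0 f)"
        using uniform_map_chain_lift assms(3,4) by blast
      show "g x0 = chain_lift \<U> x0 f x0"
        using g chain_lift_basepoint[OF assms(3)] assms(4) by simp
      show "cover_map \<circ> g = cover_map \<circ> chain_lift \<U> x0 f"
        using g cover_map_chain_lift[OF assms(3)] by (auto simp: fun_eq_iff)
    qed (use g in auto)
  qed
qed

end
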